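(* For every compact Hausdorff space $X$, one has $Dg(X)=\delta Ind(X)$, where $Dg$ is the Brouwer dimension and $\delta Ind(X)$ is the proximity inductive dimension of $X$ with respect to the unique proximity compatible with the topology of $X$ (both sides take values in $\{-1,0,1,2,\ldots\}\cup\{\infty\}$).
   Context: **Proximity spaces.** A proximity on a set $X$ is a binary relation $\delta$ on $2^X$ such that for all $A,B,C\subseteq X$: (1) $A\delta B$ iff $B\delta A$; (2) $(A\cup B)\delta C$ iff $A\delta C$ or $B\delta C$; (3) $A\delta B$ implies $A\neq\emptyset$ and $B\neq\emptyset$; (4) $A\cap B\neq\emptyset$ implies $A\delta B$; (5) $A\bar\delta B$ implies there is $E\subseteq X$ with $A\bar\delta E$ and $(X\setminus E)\bar\delta B$. Here $A\bar\delta B$ means that $A\delta B$ does not hold. The pair $(X,\delta)$ is a proximity space; its induced topology has closure operator $cl(A)=\{x\in X\mid \{x\}\delta A\}$. A proximity is compatible with a topology if it induces that topology. A compact Hausdorff space has exactly one compatible proximity, given by $A\delta B\iff\overline A\cap\overline B\neq\emptyset$. A subset $H$ of a proximity space is regarded as a proximity space with the restriction of $\delta$ to subsets of $H$. **$\delta$-neighbourhoods.** $B$ is a $\delta$-neighbourhood of $A$, written $A\ll B$, if $A\bar\delta(X\setminus B)$. **Freeing sets.** Let $A,B\subseteq X$ with $A\bar\delta B$. A subset $D\subseteq X$ is a $\delta$-separator between $A$ and $B$ if $X\setminus D=U\cup V$ with $A\subseteq U$, $B\subseteq V$, $U\cap V=\emptyset$ and $U\bar\delta V$. A subset $H\subseteq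 X$ frees $A$ and $B$ if $H\bar\delta(A\cup B)$ and every $\delta$-neighbourhood of $H$ that is disjoint from $A\cup B$ is a $\delta$-separator between $A$ and $B$. **Proximity inductive dimension $\delta Ind$.** For a proximity space $(X,\delta)$: $\delta Ind(X)=-1$ iff $X=\emptyset$; for $n\geq 0$, $\delta Ind(X)\leq n$ iff for every pair $A,B\subseteq X$ with $A\bar\delta B$ there is $H\subseteq X$ that frees $A$ and $B$ with $\delta Ind(H)\leq n-1$; $\delta Ind(X)$ is the least integer $n$ with $\delta Ind(X)\leq n$, and $\infty$ if there is none. **Cuts.** A continuum is a nonempty compact connected Hausdorff space. Given a topological space $X$ and disjoint closed $A,B\subseteq X$, a closed set $C\subseteq X$ disjoint from $A\cup B$ is a cut between $A$ and $B$ if every continuum $K\subseteq X$ with $K\cap A\neq\emptyset$ and $K\cap B\neq\emptyset$ satisfies $K\cap C\neq\emptyset$. **Brouwer dimension $Dg$.** For a $T_4$ space $X$: $Dg(X)=-1$ iff $X=\emptyset$; for $n\geq 0$, $Dg(X)\leq n$ iff for every pair of disjoint closed sets $A,B\subseteq X$ there is a cut $C\subseteq X$ between $A$ and $B$ with $Dg(C)\leq n-1$ ($C$ with the subspace topology); $Dg(X)$ is the least integer $n$ with $Dg(X)\leq n$, and $\infty$ if there is none. *)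

theory Defs
  imports "HOL-Analysis.Analysis"
begin

section \<open>Proximity spaces\<close>

text \<open>
  A proximity on the carrier \<open>S\<close> is a relation on the subsets of \<open>S\<close>; the values of \<open>\<delta>\<close> on other
  sets are irrelevant.  In particular the subspace on \<open>H \<subseteq> S\<close> is given by the same \<open>\<delta>\<close>
  with the carrier \<open>H\<close>.
\<close>

locale proximity_space =
  fixes S :: "'a set" and \<delta> :: "'a set \<Rightarrow> 'a set \<Rightarrow> bool"
  assumes near_sym: "\<And>A B. \<lbrakk>A \<subseteq> S; B \<subseteq> S\<rbrakk> \<Longrightarrow> \<delta> A B \<longleftrightarrow> \<delta> B A"
    and near_Un: "\<And>A B C. \<lbrakk>A \<subseteq> S; B \<subseteq> S; C \<subseteq> S\<rbrakk> \<Longrightarrow> \<delta> (A \<union> B) C \<longleftrightarrow> \<delta> A C \<or> \<delta> B C"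
    and near_nonempty: "\<And>A B. \<lbrakk>A \<subseteq> S; B \<subseteq> S; \<delta> A B\<rbrakk> \<Longrightarrow> A \<noteq> {} \<and> B \<noteq> {}"
    and near_Int: "\<And>A B. \<lbrakk>A \<subseteq> S; B \<subseteq> S; A \<inter> B \<noteq> {}\<rbrakk> \<Longrightarrow> \<delta> A B"
    and far_strong: "\<And>A B. \<lbrakk>A \<subseteq> S; B \<subseteq> S; \<not> \<delta> A B\<rbrakk> \<Longrightarrow> \<exists>E\<subseteq>S. \<not> \<delta> A E \<and> \<not> \<delta> (S - E) B"

definition compatible_proximity :: "'a topology \<Rightarrow> ('a set \<Rightarrow> 'a set \<Rightarrow> bool) \<Rightarrow> bool" where
  "compatible_proximity X \<delta> \<longleftrightarrow>
     proximity_space (topspace X) \<delta> \<and>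
     (\<forall>A\<subseteq>topspace X. X closure_of A = {x \<in> topspace X. \<delta> {x} A})"

definition proximity_nbhd :: "'a set \<Rightarrow> ('a set \<Rightarrow> 'a set \<Rightarrow> bool) \<Rightarrow> 'a set \<Rightarrow> 'a set \<Rightarrow> bool" where
  "proximity_nbhd S \<delta> A B \<longleftrightarrow> A \<subseteq> S \<and> B \<subseteq> S \<and> \<not> \<delta> A (S - B)"

definition proximity_separator ::
    "'a set \<Rightarrow> ('a set \<Rightarrow> 'a set \<Rightarrow> bool) \<Rightarrow> 'a set \<Rightarrow> 'a set \<Rightarrow> 'a set \<Rightarrow> bool" where
  "proximity_separator S \<delta> A B D \<longleftrightarrow>
     D \<subseteq> S \<and>
     (\<exists>U V. S - D = U \<union> V \<and> A \<subseteq> U \<and> B \<subseteq> V \<and> U \<inter> V = {} \<and> \<not> \<delta> U V)"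

definition frees ::
    "'a set \<Rightarrow> ('a set \<Rightarrow> 'a set \<Rightarrow> bool) \<Rightarrow> 'a set \<Rightarrow> 'a set \<Rightarrow> 'a set \<Rightarrow> bool" where
  "frees S \<delta> A B H \<longleftrightarrow>
     H \<subseteq> S \<and> \<not> \<delta> H (A \<union> B) \<and>
     (\<forall>D. proximity_nbhd S \<delta> H D \<and> D \<inter> (A \<union> B) = {} \<longrightarrow> proximity_separator S \<delta> A B D)"

section \<open>Proximity inductive dimension\<close>

inductive delta_Ind_le :: "('a set \<Rightarrow> 'a set \<Rightarrow> bool) \<Rightarrow> 'a set \<Rightarrow> int \<Rightarrow> bool"
  for \<delta> :: "'a set \<Rightarrow> 'a set \<Rightarrow> bool" where
  empty: "delta_Ind_le \<delta> {} (-1)"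
| step: "\<lbrakk>0 \<le> n;
          \<And>A B. \<lbrakk>A \<subseteq> S; B \<subseteq> S; \<not> \<delta> A B\<rbrakk> \<Longrightarrow>
             \<exists>H. frees S \<delta> A B H \<and> delta_Ind_le \<delta> H (n - 1)\<rbrakk>
         \<Longrightarrow> delta_Ind_le \<delta> S n"

text \<open>
  The least integer below exists because \<open>delta_Ind_le \<delta> S n\<close> forces \<open>n \<ge> -1\<close>; likewise
  for the Brouwer dimension.
\<close>

definition delta_Ind :: "'a set \<Rightarrow> ('a set \<Rightarrow> 'a set \<Rightarrow> bool) \<Rightarrow> ereal" where
  "delta_Ind S \<delta> =
     (if \<exists>n. delta_Ind_le \<delta> S n then ereal (real_of_int (LEAST n. delta_Ind_le \<delta> S n)) else \<infinity>)"

section \<open>Brouwer dimension\<close>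

definition continuum_space :: "'a topology \<Rightarrow> bool" where
  "continuum_space X \<longleftrightarrow>
     topspace X \<noteq> {} \<and> compact_space X \<and> connected_space X \<and> Hausdorff_space X"

definition cut_between :: "'a topology \<Rightarrow> 'a set \<Rightarrow> 'a set \<Rightarrow> 'a set \<Rightarrow> bool" where
  "cut_between X A B C \<longleftrightarrow>
     closedin X C \<and> C \<inter> (A \<union> B) = {} \<and>
     (\<forall>K\<subseteq>topspace X. continuum_space (subtopology X K) \<and> K \<inter> A \<noteq> {} \<and> K \<inter> B \<noteq> {}
        \<longrightarrow> K \<inter> C \<noteq> {})"

inductive Dg_le :: "'a topology \<Rightarrow> int \<Rightarrow> bool" where
  empty: "topspace X = {} \<Longrightarrow> Dg_le X (-1)"
| step: "\<lbrakk>0 \<le> n;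
          \<And>A B. \<lbrakk>closedin X A; closedin X B; A \<inter> B = {}\<rbrakk> \<Longrightarrow>
             \<exists>C. cut_between X A B C \<and> Dg_le (subtopology X C) (n - 1)\<rbrakk>
         \<Longrightarrow> Dg_le X n"

definition Dg :: "'a topology \<Rightarrow> ereal" where
  "Dg X = (if \<exists>n. Dg_le X n then ereal (real_of_int (LEAST n. Dg_le X n)) else \<infinity>)"

section \<open>The compatible proximity of a compact Hausdorff space\<close>

lemma (in proximity_space) near_mono:
  assumes "\<delta> A B" "A \<subseteq> A'" "B \<subseteq> B'" "A' \<subseteq> S" "B' \<subseteq> S"
  shows "\<delta> A' B'"
proof -
  have 1: "\<delta> (A \<union> A') B"
    using near_Un[of A A' B] assms by blast
  then have "\<delta> B A'"
    using near_sym[of A' B] assms by (simp add: Un_absorb1)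
  then have "\<delta> (B \<union> B') A'"
    using near_Un[of B B' A'] assms by blast
  then show ?thesis
    using near_sym[of A' B'] assms by (simp add: Un_absorb1)
qed

lemma compatible_proximity_exists:
  assumes "compact_space X" "Hausdorff_space X"
  shows "compatible_proximity X (\<lambda>A B. X closure_of A \<inter> X closure_of B \<noteq> {})"
proof -
  have nrm: "normal_space X"
    using assms compact_Hausdorff_or_regular_imp_normal_space by blast
  have "\<exists>E\<subseteq>topspace X. X closure_of A \<inter> X closure_of E = {} \<and>
          X closure_of (topspace X - E) \<inter> X closure_of B = {}"
    if disj: "X closure_of A \<inter> X closure_of B = {}" for A B
  proof -
    obtain U V where UV: "openin X U" "openin X V" "X closure_of A \<subseteq> U" "X closure_of B \<subseteq> V"
        "disjnt U V"
      using nrm[unfolded normal_space_def, rule_format, of "X closure_of A" "X closure_of B"] disj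
      by (auto simp: disjnt_def)
    have 1: "X closure_of (topspace X - U) = topspace X - U"
      by (rule closure_of_closedin) (use UV in blast)
    have 2: "topspace X - (topspace X - U) = U"
      using openin_subset[OF UV(1)] by blast
    have "U \<subseteq> topspace X - V"
      using openin_subset[OF UV(1)] UV(5) unfolding disjnt_def by blast
    moreover have "closedin X (topspace X - V)"
      using UV by blast
    ultimately have "X closure_of U \<subseteq> topspace X - V"
      by (rule closure_of_minimal)
    with 1 2 UV show ?thesis
      by (intro exI[of _ "topspace X - U"]) auto
  qed
  then have "proximity_space (topspace X) (\<lambda>A B. X closure_of A \<inter> X closure_of B \<noteq> {})"
  proof (unfold_locales, goal_cases)
    case (4 A B)
    then show ?case using closure_of_subset[of A X] closure_of_subset[of B X] by blast
  qed auto
  moreover have "X closure_of A = {x \<in> topspace X. X closure_of {x} \<inter> X closure_of A \<noteq> {}}" for A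
  proof -
    have "X closure_of {x} = {x}" if "x \<in> topspace X" for x
      using assms that by (simp add: closure_of_closedin closedin_Hausdorff_singleton)
    then show ?thesis using closure_of_subset_topspace[of X A] by auto
  qed
  ultimately show ?thesis
    unfolding compatible_proximity_def by blast
qed

lemma compatible_proximity_unique:
  assumes X: "compact_space X" and \<delta>: "compatible_proximity X \<delta>"
    and AB: "A \<subseteq> topspace X" "B \<subseteq> topspace X"
  shows "\<delta> A B \<longleftrightarrow> X closure_of A \<inter> X closure_of B \<noteq> {}"
proof -
  interpret proximity_space "topspace X" \<delta>
    using \<delta> by (simp add: compatible_proximity_def)
  have cl: "X closure_of C = {x \<in> topspace X. \<delta> {x} C}" if "C \<subseteq> topspace X" for C
    using \<delta> that by (simp add: compatible_proximity_def)
  show ?thesis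
  proof
    assume "X closure_of A \<inter> X closure_of B \<noteq> {}"
    then obtain x where x: "x \<in> topspace X" "\<delta> {x} A" "\<delta> {x} B"
      using cl[OF AB(1)] cl[OF AB(2)] by auto
    show "\<delta> A B"
    proof (rule ccontr)
      assume "\<not> \<delta> A B"
      then obtain E where E: "E \<subseteq> topspace X" "\<not> \<delta> A E" "\<not> \<delta> (topspace X - E) B"
        using far_strong[OF AB] by blast
      show False
      proof (cases "x \<in> E")
        case True
        then have "\<delta> E A" using near_mono[OF x(2), of E A] E(1) AB(1) by simp
        then show False using E(2) near_sym[OF AB(1) E(1)] by simp
      next
        case False
        then have "\<delta> (topspace X - E) B"
          using near_mono[OF x(3), of "topspace X - E" B] x(1) AB(2) by simp
        then show False using E(3) by simp
      qed
    qed
  next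
    assume near: "\<delta> A B"
    show "X closure_of A \<inter> X closure_of B \<noteq> {}"
    proof
      assume disj: "X closure_of A \<inter> X closure_of B = {}"
      let ?\<U> = "{U. openin X U \<and> \<not> \<delta> U B}"
      have "\<exists>U\<in>?\<U>. x \<in> U" if "x \<in> X closure_of A" for x
      proof -
        have x: "x \<in> topspace X" "\<not> \<delta> {x} B"
          using that disj cl[OF AB(1)] cl[OF AB(2)] by auto
        then obtain E where E: "E \<subseteq> topspace X" "\<not> \<delta> {x} E" "\<not> \<delta> (topspace X - E) B"
          using far_strong[of "{x}" B] AB(2) by auto
        let ?U = "topspace X - X closure_of E"
        have "?U \<subseteq> topspace X - E" using closure_of_subset[OF E(1)] by blast
        then have "\<not> \<delta> ?U B" using near_mono[of ?U B "topspace X - E" B] E(3) AB(2) by auto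
        moreover have "x \<in> ?U" using x E cl[OF E(1)] by auto
        moreover have "openin X ?U" by (simp add: openin_diff)
        ultimately show ?thesis by (intro bexI[of _ ?U]) simp_all
      qed
      then have "X closure_of A \<subseteq> \<Union>?\<U>" by (intro subsetI) (simp only: Union_iff)
      moreover have "compactin X (X closure_of A)"
        by (simp add: X closedin_compact_space)
      ultimately obtain \<F> where F: "finite \<F>" "\<F> \<subseteq> ?\<U>" "X closure_of A \<subseteq> \<Union>\<F>"
        using compactinD[of X "X closure_of A" ?\<U>] by auto
      have "\<Union>\<F> \<subseteq> topspace X \<and> \<not> \<delta> (\<Union>\<F>) B"
        using F(1,2)
      proof (induction \<F>)
        case empty
        then show ?case using near_nonempty[of "{}" B] AB by auto
      next
        case (insert U \<F>)
        then show ?case using near_Un[of U "\<Union>\<F>" B] AB openin_subset[of X U] by auto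
      qed
      moreover have "A \<subseteq> \<Union>\<F>" using F(3) closure_of_subset[OF AB(1)] by (rule subset_trans[rotated])
      ultimately show False using near near_mono[of A B "\<Union>\<F>" B] AB(2) by simp
    qed
  qed
qed

end

theory Submission
  imports Defs
begin

text \<open>
  In a compact Hausdorff space components and quasi-components coincide, so a cut frees its
  two sides: off a neighbourhood of the cut, no component meets both
  sides, hence a clopen set separates them.  Conversely, if a subset of a dense set
  frees two sets, its closure is a cut, because a continuum avoiding the closure also avoids a neighbourhood of
  it, and the corresponding separator disconnects the continuum.  Hence both dimensions can be
  compared by induction, provided the proximity dimension is followed through
  non-closed subspaces by passing to closures.
\<close>

text \<open>Two points that cannot be separated share a quasi-component, hence a component, and in a
  compact Hausdorff space that component is itself a continuum joining them.\<close>

lemma separated_between_if_no_continuum: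
  assumes X: "compact_space X" "Hausdorff_space X"
    and AB: "closedin X A" "closedin X B"
    and no: "\<And>K. \<lbrakk>K \<subseteq> topspace X; continuum_space (subtopology X K); K \<inter> A \<noteq> {}; K \<inter> B \<noteq> {}\<rbrakk> \<Longrightarrow> False"
  shows "separated_between X A B"
proof -
  have cpt: "compactin X A" "compactin X B"
    using X AB by (simp_all add: closedin_compact_space)
  have sub: "A \<subseteq> topspace X" "B \<subseteq> topspace X"
    using AB by (simp_all add: closedin_subset)
  have "separated_between X {a} {b}" if ab: "a \<in> A" "b \<in> B" for a b
  proof (rule ccontr)
    assume "\<not> separated_between X {a} {b}"
    then have "quasi_component_of X a b"
      using ab sub separated_between_singletons by fastforce
    moreover have "quasi_components_of X = connected_components_of X"
      using X by (simp add: quasi_eq_connected_components_of)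
    ultimately have b: "b \<in> connected_component_of_set X a"
      by (simp add: quasi_eq_connected_components_of_pointwise_alt)
    let ?K = "connected_component_of_set X a"
    have a: "a \<in> ?K"
      using ab sub by (auto simp: connected_component_of_refl)
    have "closedin X ?K" "connectedin X ?K" "?K \<subseteq> topspace X"
      by (simp_all add: closedin_connected_component_of connectedin_connected_component_of
          connected_component_of_subset_topspace)
    then have "continuum_space (subtopology X ?K)"
      using X a unfolding continuum_space_def
      by (auto simp: compact_space_subtopology closedin_compact_space connectedin_def
          Hausdorff_space_subtopology)
    then show False
      using no[of ?K] a b ab \<open>?K \<subseteq> topspace X\<close> by blast
  qed
  \<comment> \<open>Separation of points extends to the sets in two passes: compactness of
    \<open>A\<close> for each fixed \<open>b\<close>, then compactness of \<open>B\<close>.\<close>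
  then have "separated_between X A {b}" if "b \<in> B" for b
    using that cpt sub by (subst separated_between_pointwise_left) auto
  then show ?thesis
    using cpt sub by (subst separated_between_pointwise_right) auto
qed

text \<open>The complement \<open>R\<close> of a neighbourhood of \<open>C\<close> need not be
  compact, so the partition is first found in its closure \<open>Q\<close>. As \<open>C\<close> is
  closed and far from \<open>R\<close>, it misses \<open>Q\<close>; thus no continuum in
  \<open>Q\<close> joins the two closures, and a clopen partition of \<open>Q\<close> can be
  restricted to \<open>R\<close>.\<close>

lemma cut_between_imp_frees:
  assumes X: "compact_space X" "Hausdorff_space X"
    and \<delta>: "\<And>A B. \<lbrakk>A \<subseteq> topspace X; B \<subseteq> topspace X\<rbrakk> \<Longrightarrow> \<delta> A B \<longleftrightarrow> X closure_of A \<inter> X closure_of B \<noteq> {}"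
    and AB: "A \<subseteq> topspace X" "B \<subseteq> topspace X"
    and cut: "cut_between X (X closure_of A) (X closure_of B) C"
  shows "frees (topspace X) \<delta> A B C"
proof -
  have C: "closedin X C" "C \<inter> (X closure_of A \<union> X closure_of B) = {}" "C \<subseteq> topspace X"
    using cut closedin_subset unfolding cut_between_def by auto
  have noK: "False" if "K \<subseteq> topspace X" "continuum_space (subtopology X K)"
    "K \<inter> X closure_of A \<noteq> {}" "K \<inter> X closure_of B \<noteq> {}" "K \<inter> C = {}" for K
    using cut that unfolding cut_between_def by blast
  have "proximity_separator (topspace X) \<delta> A B D"
    if D: "proximity_nbhd (topspace X) \<delta> C D" "D \<inter> (A \<union> B) = {}" for D
  proof -
    define R where "R = topspace X - D"
    define Q where "Q = X closure_of R"
    have DX: "D \<subseteq> topspace X" and "\<not> \<delta> C R"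
      using D(1) unfolding proximity_nbhd_def R_def by auto
    then have CQ: "C \<inter> Q = {}"
      using \<delta>[of C R] C by (simp add: R_def Q_def closure_of_closedin)
    have R: "R \<subseteq> Q" "A \<subseteq> R" "B \<subseteq> R"
      using D(2) AB by (auto simp: Q_def R_def closure_of_subset)
    then have cl: "X closure_of A \<subseteq> Q" "X closure_of B \<subseteq> Q"
      by (simp_all add: Q_def closure_of_mono)
    have Q: "closedin X Q" "Q \<subseteq> topspace X"
      by (auto simp: Q_def closure_of_subset_topspace)
    let ?Q = "subtopology X Q"
    have "separated_between ?Q (X closure_of A) (X closure_of B)"
    proof (rule separated_between_if_no_continuum)
      show "compact_space ?Q" "Hausdorff_space ?Q"
        using X Q by (simp_all add: closedin_compact_space compact_space_subtopology
            Hausdorff_space_subtopology)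
      show "closedin ?Q (X closure_of A)" "closedin ?Q (X closure_of B)"
        using Q cl by (simp_all add: closedin_closed_subtopology)
    next
      fix K assume K: "K \<subseteq> topspace ?Q" "continuum_space (subtopology ?Q K)"
        "K \<inter> X closure_of A \<noteq> {}" "K \<inter> X closure_of B \<noteq> {}"
      then have "K \<subseteq> Q" "K \<subseteq> topspace X" by auto
      then show False
        using noK[of K] K CQ by (auto simp: subtopology_subtopology Int_absorb1)
    qed
    then obtain U V where UV: "closedin ?Q U" "closedin ?Q V" "U \<union> V = Q" "U \<inter> V = {}"
        "X closure_of A \<subseteq> U" "X closure_of B \<subseteq> V"
      using Q unfolding separated_between_alt disjnt_def by (auto simp: Int_absorb1)
    then have UVX: "closedin X U" "closedin X V"
      using Q closedin_closed_subtopology by blast+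
    \<comment> \<open>Both pieces are closed in the whole space, so their traces on \<open>R\<close>
      have disjoint closures, which makes them far and not merely disjoint.\<close>
    have "X closure_of (U \<inter> R) \<subseteq> U" "X closure_of (V \<inter> R) \<subseteq> V"
      using UVX by (simp_all add: closure_of_minimal)
    then have "\<not> \<delta> (U \<inter> R) (V \<inter> R)"
      using \<delta>[of "U \<inter> R" "V \<inter> R"] UV(4) by (auto simp: R_def)
    moreover have "R = (U \<inter> R) \<union> (V \<inter> R)"
      using UV(3) R by auto
    moreover have "A \<subseteq> U \<inter> R" "B \<subseteq> V \<inter> R"
      using UV(5,6) R(2,3) closure_of_subset[OF AB(1)] closure_of_subset[OF AB(2)] by auto
    moreover have "(U \<inter> R) \<inter> (V \<inter> R) = {}"
      using UV(4) by auto
    ultimately show ?thesis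
      using DX unfolding proximity_separator_def R_def[symmetric] by meson
  qed
  moreover have "\<not> \<delta> C (A \<union> B)"
    using \<delta>[of C "A \<union> B"] C AB by (simp add: closure_of_closedin)
  ultimately show ?thesis
    using C unfolding frees_def by blast
qed

text \<open>The relation \<delta> stays fixed while the space shrinks to a cut. Its description by
  closures survives this, because a cut is closed and so closures of its subsets are the same in the
  cut and in the space.\<close>

lemma delta_Ind_le_if_Dg_le:
  assumes "Dg_le X n" "compact_space X" "Hausdorff_space X"
    and "\<And>A B. \<lbrakk>A \<subseteq> topspace X; B \<subseteq> topspace X\<rbrakk> \<Longrightarrow> \<delta> A B \<longleftrightarrow> X closure_of A \<inter> X closure_of B \<noteq> {}"
  shows "delta_Ind_le \<delta> (topspace X) n"
  using assms
proof (induction rule: Dg_le.induct)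
  case (empty X)
  then show ?case by (simp add: delta_Ind_le.empty)
next
  case (step n X)
  note \<delta> = step.prems(3)
  show ?case
  proof (rule delta_Ind_le.step)
    fix A B assume AB: "A \<subseteq> topspace X" "B \<subseteq> topspace X" "\<not> \<delta> A B"
    then have "X closure_of A \<inter> X closure_of B = {}"
      using \<delta> by blast
    then obtain C where C: "cut_between X (X closure_of A) (X closure_of B) C"
      and IH: "\<lbrakk>compact_space (subtopology X C); Hausdorff_space (subtopology X C);
        \<And>A' B'. \<lbrakk>A' \<subseteq> topspace (subtopology X C); B' \<subseteq> topspace (subtopology X C)\<rbrakk> \<Longrightarrow>
          \<delta> A' B' \<longleftrightarrow> subtopology X C closure_of A' \<inter> subtopology X C closure_of B' \<noteq> {}\<rbrakk> \<Longrightarrow>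
        delta_Ind_le \<delta> (topspace (subtopology X C)) (n - 1)"
      using step.IH[of "X closure_of A" "X closure_of B"] by auto
    have clC: "closedin X C" and CX: "C \<subseteq> topspace X"
      using C closedin_subset unfolding cut_between_def by auto
    have "subtopology X C closure_of A' = X closure_of A'" if "A' \<subseteq> C" for A'
      using that clC closure_of_minimal[of A' C X]
      by (simp add: closure_of_subtopology Int_absorb1 Int_absorb2)
    then have "delta_Ind_le \<delta> (topspace (subtopology X C)) (n - 1)"
      using IH clC step.prems
      by (simp add: closedin_compact_space compact_space_subtopology Hausdorff_space_subtopology)
    moreover have "frees (topspace X) \<delta> A B C"
      using cut_between_imp_frees[of X \<delta>] step.prems AB C by blast
    ultimately show "\<exists>H. frees (topspace X) \<delta> A B H \<and> delta_Ind_le \<delta> H (n - 1)"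
      using CX by (auto simp: Int_absorb1)
  qed (fact step.hyps)
qed

text \<open>Closed sets \<open>A\<close> and \<open>B\<close> may miss the dense set
  \<open>H\<close> altogether, so what is freed inside \<open>H\<close> are the traces of open sets
  around them; by density the closures of these traces still contain \<open>A\<close> and
  \<open>B\<close>.\<close>

lemma frees_dense_imp_cut_between:
  assumes X: "normal_space X" "Hausdorff_space X"
    and H: "H \<subseteq> topspace X" "X closure_of H = topspace X"
    and \<delta>: "\<And>A B. \<lbrakk>A \<subseteq> H; B \<subseteq> H\<rbrakk> \<Longrightarrow> \<delta> A B \<longleftrightarrow> X closure_of A \<inter> X closure_of B \<noteq> {}"
    and UV: "openin X U" "openin X V" "A \<subseteq> U" "B \<subseteq> V"
    and F: "frees H \<delta> (U \<inter> H) (V \<inter> H) F"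
  shows "cut_between X A B (X closure_of F)"
proof -
  have FH: "F \<subseteq> H" and far: "\<not> \<delta> F ((U \<inter> H) \<union> (V \<inter> H))"
    using F unfolding frees_def by auto
  have dense: "W \<subseteq> X closure_of (W \<inter> H)" if "openin X W" for W
    using openin_Int_closure_of_subset[OF that, of H] H openin_subset[OF that] by auto
  have FUV: "X closure_of F \<inter> X closure_of ((U \<inter> H) \<union> (V \<inter> H)) = {}"
    using \<delta>[of F "(U \<inter> H) \<union> (V \<inter> H)"] far FH by auto
  have "K \<inter> X closure_of F \<noteq> {}"
    if K: "K \<subseteq> topspace X" "continuum_space (subtopology X K)" "K \<inter> A \<noteq> {}" "K \<inter> B \<noteq> {}" for K
  proof
    assume disj: "K \<inter> X closure_of F = {}"
    have conn: "connectedin X K" and "compactin X K"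
      using K(1,2) unfolding continuum_space_def connectedin_def by (auto simp: compactin_subspace)
    then have "closedin X K"
      using X(2) compactin_imp_closedin by blast
    \<comment> \<open>\<open>K\<close> may miss \<open>H\<close> too, so it is thickened to an open
      \<open>W\<close>, which density makes visible in \<open>H\<close>.\<close>
    then obtain W where W: "openin X W" "K \<subseteq> W" "X closure_of W \<inter> X closure_of F = {}"
      using X(1)[unfolded normal_space, rule_format, of K "X closure_of F"] disj
      by (auto simp: disjnt_def Int_commute)
    \<comment> \<open>The complement \<open>R\<close> of \<open>D\<close> in \<open>H\<close> stays
      far from \<open>F\<close>, yet contains \<open>W \<inter> H\<close> and both traces. Hence the
      pieces of a separation of \<open>R\<close> have closures that cover \<open>K\<close> and
      contain \<open>A\<close> and \<open>B\<close> respectively.\<close>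
    define D where "D = H - (X closure_of W \<union> U \<union> V)"
    define R where "R = H - D"
    have "R \<subseteq> X closure_of W \<union> ((U \<inter> H) \<union> (V \<inter> H))"
      by (auto simp: R_def D_def)
    then have "X closure_of R \<subseteq> X closure_of W \<union> X closure_of ((U \<inter> H) \<union> (V \<inter> H))"
      by (metis closure_of_mono closure_of_Un closure_of_closure_of)
    then have "\<not> \<delta> F R"
      using \<delta>[of F R] FH FUV W(3) by (auto simp: R_def)
    then have "proximity_nbhd H \<delta> F D" "D \<inter> ((U \<inter> H) \<union> (V \<inter> H)) = {}"
      using FH unfolding proximity_nbhd_def R_def by (auto simp: D_def)
    then have "proximity_separator H \<delta> (U \<inter> H) (V \<inter> H) D"
      using F unfolding frees_def by blast
    then obtain P Q where PQ: "R = P \<union> Q" "U \<inter> H \<subseteq> P" "V \<inter> H \<subseteq> Q" "\<not> \<delta> P Q"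
      unfolding proximity_separator_def R_def by blast
    then have disjPQ: "X closure_of P \<inter> X closure_of Q = {}"
      using \<delta>[of P Q] by (auto simp: R_def)
    have "W \<inter> H \<subseteq> P \<union> Q"
      using closure_of_subset[of W X] openin_subset[OF W(1)]
      unfolding PQ(1)[symmetric] R_def D_def by blast
    then have "K \<subseteq> X closure_of P \<union> X closure_of Q"
      using dense[OF W(1)] W(2) closure_of_mono[of "W \<inter> H" "P \<union> Q" X] by auto
    moreover have "A \<subseteq> X closure_of P" "B \<subseteq> X closure_of Q"
      using dense[OF UV(1)] dense[OF UV(2)] UV(3,4) closure_of_mono[OF PQ(2), of X]
        closure_of_mono[OF PQ(3), of X] by auto
    ultimately have "K \<subseteq> X closure_of P \<union> X closure_of Q"
        "X closure_of P \<inter> X closure_of Q \<inter> K = {}"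
        "X closure_of P \<inter> K \<noteq> {}" "X closure_of Q \<inter> K \<noteq> {}"
      using K(3,4) disjPQ by blast+
    then show False
      using conn closedin_closure_of[of X P] closedin_closure_of[of X Q]
      unfolding connectedin_closedin by blast
  qed
  then show ?thesis
    using FUV dense[OF UV(1)] dense[OF UV(2)] UV(3,4) unfolding cut_between_def by auto
qed

text \<open>Freeing sets need not be closed, so the induction runs over arbitrary \<open>H\<close>
  inside a fixed \<open>X\<close> and bounds the dimension of the closure of \<open>H\<close>, in
  which \<open>H\<close> is dense.\<close>

lemma Dg_le_if_delta_Ind_le:
  assumes X: "compact_space X" "Hausdorff_space X"
    and \<delta>: "\<And>A B. \<lbrakk>A \<subseteq> topspace X; B \<subseteq> topspace X\<rbrakk> \<Longrightarrow> \<delta> A B \<longleftrightarrow> X closure_of A \<inter> X closure_of B \<noteq> {}"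
    and "delta_Ind_le \<delta> H n" "H \<subseteq> topspace X"
  shows "Dg_le (subtopology X (X closure_of H)) n"
  using assms(4,5)
proof (induction rule: delta_Ind_le.induct)
  case empty
  then show ?case by (simp add: Dg_le.empty)
next
  case (step n H)
  define Y where "Y = subtopology X (X closure_of H)"
  have HX: "H \<subseteq> topspace X" by fact
  have topY: "topspace Y = X closure_of H"
    by (simp add: Y_def Int_absorb1 closure_of_subset_topspace)
  have HY: "H \<subseteq> topspace Y"
    by (simp add: topY closure_of_subset HX)
  \<comment> \<open>This lets the closure description of \<delta> in \<open>X\<close> be read in
    \<open>Y\<close>.\<close>
  have clY: "Y closure_of S = X closure_of S" if "S \<subseteq> H" for S
    using that HY topY closure_of_mono[OF that, of X]
    by (simp add: Y_def closure_of_subtopology Int_absorb1 order_trans[OF that])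
  have nY: "normal_space Y" "Hausdorff_space Y"
    using X compact_Hausdorff_or_regular_imp_normal_space[of X] unfolding Y_def
    by (simp_all add: normal_space_closed_subtopology Hausdorff_space_subtopology)
  have "Dg_le Y n"
  proof (rule Dg_le.step)
    fix A B assume AB: "closedin Y A" "closedin Y B" "A \<inter> B = {}"
    \<comment> \<open>Disjoint closures are demanded, since the traces of \<open>U\<close> and
      \<open>V\<close> on \<open>H\<close> have to be far before the hypothesis on \<open>H\<close>
      applies.\<close>
    then obtain U V where UV: "openin Y U" "openin Y V" "A \<subseteq> U" "B \<subseteq> V"
        "Y closure_of U \<inter> Y closure_of V = {}"
      using nY(1)[unfolded normal_space_disjoint_closures, rule_format, of A B]
      by (auto simp: disjnt_def)
    then have "Y closure_of (U \<inter> H) \<inter> Y closure_of (V \<inter> H) = {}"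
      using closure_of_mono[of "U \<inter> H" U Y] closure_of_mono[of "V \<inter> H" V Y] by auto
    then have "\<not> \<delta> (U \<inter> H) (V \<inter> H)"
      using \<delta>[of "U \<inter> H" "V \<inter> H"] HX clY by auto
    then obtain F where F: "frees H \<delta> (U \<inter> H) (V \<inter> H) F"
      and IH: "F \<subseteq> topspace X \<Longrightarrow> Dg_le (subtopology X (X closure_of F)) (n - 1)"
      using step.IH[of "U \<inter> H" "V \<inter> H"] by auto
    have FH: "F \<subseteq> H"
      using F unfolding frees_def by auto
    have "cut_between Y A B (Y closure_of F)"
    proof (rule frees_dense_imp_cut_between[OF nY HY _ _ UV(1-4) F])
      show "Y closure_of H = topspace Y"
        by (simp add: clY topY)
      show "\<delta> S T \<longleftrightarrow> Y closure_of S \<inter> Y closure_of T \<noteq> {}" if "S \<subseteq> H" "T \<subseteq> H" for S T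
        using \<delta>[of S T] that HX by (simp add: clY)
    qed
    \<comment> \<open>The induction hypothesis speaks of closures in \<open>X\<close>, whereas the
      cut is a subspace of \<open>Y\<close>.\<close>
    moreover have "subtopology Y (Y closure_of F) = subtopology X (X closure_of F)"
      unfolding clY[OF FH] using closure_of_mono[OF FH, of X]
      by (simp add: Y_def subtopology_subtopology Int_absorb1)
    ultimately show "\<exists>C. cut_between Y A B C \<and> Dg_le (subtopology Y C) (n - 1)"
      using IH FH HX by auto
  qed (fact step.hyps)
  then show ?case by (simp add: Y_def)
qed

theorem theorem4p3:
  fixes X :: "'a topology" and \<delta> :: "'a set \<Rightarrow> 'a set \<Rightarrow> bool"
  assumes "compact_space X" and "Hausdorff_space X"
    and "compatible_proximity X \<delta>"
  shows "Dg X = delta_Ind (topspace X) \<delta>"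
proof -
  note \<delta> = compatible_proximity_unique[OF assms(1,3)]
  \<comment> \<open>Equality of the predicates settles the finite and the infinite case together.
    For one direction \<open>H\<close> is the whole space, which is its own closure.\<close>
  have "Dg_le X = delta_Ind_le \<delta> (topspace X)"
  proof
    show "Dg_le X n \<longleftrightarrow> delta_Ind_le \<delta> (topspace X) n" for n
      using delta_Ind_le_if_Dg_le[OF _ assms(1,2) \<delta>, of n]
        Dg_le_if_delta_Ind_le[OF assms(1,2) \<delta>, of "topspace X" n] by auto
  qed
  then show ?thesis
    by (simp add: Dg_def delta_Ind_def)
qed

end
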